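(* Let $k$ be a positive integer and let $G=(V,E)$ be a finite, simple, connected graph on $n=n(G)$ vertices with minimum degree $\delta$ and maximum degree $\Delta\ge k+1$. (i) If $\delta<\Delta=k+1$, then $F_k(G)=1$. (ii) If $\delta=\Delta=k+1$, then $F_k(G)=2$. (iii) If $\Delta\ge k+2$, then \[ F_k(G)\le \frac{(\Delta-k-1)\,n+\max\{\delta(k+1-\Delta)+k,\ k(\delta-\Delta+2)\}}{\Delta-1}. \]
   Context: All graphs are finite, simple and undirected. For a positive integer $k$, a set $S\subseteq V$ is a $k$-forcing set of $G$ if the following process colors every vertex of $G$: initially the vertices of $S$ are colored and all others are uncolored; repeatedly, whenever a colored vertex has at most $k$ uncolored neighbors, all of its uncolored neighbors become colored. The $k$-forcing number $F_k(G)$ is the minimum cardinality of a $k$-forcing set of $G$. *)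

theory Defs
  imports Complex_Main
begin

definition simple_graph :: "'a set \<Rightarrow> ('a \<Rightarrow> 'a \<Rightarrow> bool) \<Rightarrow> bool" where
  "simple_graph V E \<longleftrightarrow> finite V \<and> (\<forall>u v. E u v \<longrightarrow> u \<in> V \<and> v \<in> V)
     \<and> (\<forall>u v. E u v \<longrightarrow> E v u) \<and> (\<forall>v. \<not> E v v)"

definition neighbors :: "'a set \<Rightarrow> ('a \<Rightarrow> 'a \<Rightarrow> bool) \<Rightarrow> 'a \<Rightarrow> 'a set" where
  "neighbors V E v = {u \<in> V. E v u}"

definition degree :: "'a set \<Rightarrow> ('a \<Rightarrow> 'a \<Rightarrow> bool) \<Rightarrow> 'a \<Rightarrow> nat" where
  "degree V E v = card (neighbors V E v)"

definition min_degree :: "'a set \<Rightarrow> ('a \<Rightarrow> 'a \<Rightarrow> bool) \<Rightarrow> nat" where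
  "min_degree V E = Min (degree V E ` V)"

definition max_degree :: "'a set \<Rightarrow> ('a \<Rightarrow> 'a \<Rightarrow> bool) \<Rightarrow> nat" where
  "max_degree V E = Max (degree V E ` V)"

definition connected_graph :: "'a set \<Rightarrow> ('a \<Rightarrow> 'a \<Rightarrow> bool) \<Rightarrow> bool" where
  "connected_graph V E \<longleftrightarrow> V \<noteq> {} \<and> (\<forall>u\<in>V. \<forall>v\<in>V. E\<^sup>*\<^sup>* u v)"

definition kforce_step :: "nat \<Rightarrow> 'a set \<Rightarrow> ('a \<Rightarrow> 'a \<Rightarrow> bool) \<Rightarrow> 'a set \<Rightarrow> 'a set" where
  "kforce_step k V E C = C \<union>
     \<Union> {neighbors V E v | v. v \<in> C \<and> card (neighbors V E v - C) \<le> k}"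

definition is_kforcing_set :: "nat \<Rightarrow> 'a set \<Rightarrow> ('a \<Rightarrow> 'a \<Rightarrow> bool) \<Rightarrow> 'a set \<Rightarrow> bool" where
  "is_kforcing_set k V E S \<longleftrightarrow> S \<subseteq> V \<and> (\<exists>m. (kforce_step k V E ^^ m) S = V)"

definition kforcing_number :: "nat \<Rightarrow> 'a set \<Rightarrow> ('a \<Rightarrow> 'a \<Rightarrow> bool) \<Rightarrow> nat" where
  "kforcing_number k V E = (LEAST c. \<exists>S. is_kforcing_set k V E S \<and> card S = c)"

end

theory Submission
  imports Defs
begin

text \<open>
  Color a vertex \<open>v\<close> of minimum degree together with \<open>\<delta> - k\<close> of its neighbors; one step colors its
  closed neighborhood. From then on every colored vertex with an uncolored neighbor also has a
  colored one, hence at most \<open>u \<le> \<Delta> - 1\<close> uncolored neighbors, and adding \<open>u - k\<close> of these to the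
  initial set makes it force the remaining ones. So every extension pays at most
  \<open>(\<Delta> - 1 - k) / (\<Delta> - 1)\<close> initial vertices per newly colored vertex, and connectedness makes the
  extensions exhaust the graph. If \<open>\<Delta> = k + 1\<close>, the extensions are free, so that \<open>1 + (\<delta> - k)\<close>
  initial vertices suffice; fewer never do, since each of them would keep more than \<open>k\<close> uncolored
  neighbors.
\<close>

lemma finite_neighbors: "finite V \<Longrightarrow> finite (neighbors V E v)"
  by (simp add: neighbors_def)

lemma card_neighbors_Diff_less_degree:
  assumes "finite V" "x \<in> C" "x \<in> neighbors V E w"
  shows "card (neighbors V E w - C) < degree V E w"
  unfolding degree_def using assms by (intro psubset_card_mono finite_neighbors) auto

lemma card_neighbors_Diff_Un_neighbors_le:
  assumes graph: "simple_graph V E" and deg: "\<And>w. w \<in> V \<Longrightarrow> degree V E w \<le> d + 1"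
    and w: "w \<in> C" and le: "\<And>z. z \<in> C \<Longrightarrow> z \<noteq> w \<Longrightarrow> card (neighbors V E z - C) \<le> d"
    and z: "z \<in> C \<union> neighbors V E w"
  shows "card (neighbors V E z - (C \<union> neighbors V E w)) \<le> d"
proof -
  have finV: "finite V"
    using graph by (simp add: simple_graph_def)
  consider (center) "z = w" | (colored) "z \<in> C" "z \<noteq> w" | (neighbor) "z \<in> neighbors V E w"
    using z by blast
  then show ?thesis
  proof cases
    case center
    then have "neighbors V E z - (C \<union> neighbors V E w) = {}"
      by auto
    then show ?thesis
      by (simp only: card.empty)
  next
    case colored
    have "card (neighbors V E z - (C \<union> neighbors V E w)) \<le> card (neighbors V E z - C)"
      using finV by (intro card_mono) (auto simp: finite_neighbors)
    then show ?thesis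
      using le[OF colored] by simp
  next
    case neighbor
    then have "w \<in> neighbors V E z" "z \<in> V"
      using graph by (auto simp: neighbors_def simple_graph_def)
    then show ?thesis
      using card_neighbors_Diff_less_degree[OF finV, of w "C \<union> neighbors V E w" E z] deg[of z] w
      by simp
  qed
qed

lemma min_degree_le_degree: "finite V \<Longrightarrow> v \<in> V \<Longrightarrow> min_degree V E \<le> degree V E v"
  by (simp add: min_degree_def)

lemma degree_le_max_degree: "finite V \<Longrightarrow> v \<in> V \<Longrightarrow> degree V E v \<le> max_degree V E"
  by (simp add: max_degree_def)

lemma min_degree_attained:
  assumes "finite V" "V \<noteq> {}"
  obtains v where "v \<in> V" "degree V E v = min_degree V E"
proof -
  have "min_degree V E \<in> degree V E ` V"
    unfolding min_degree_def using assms by (intro Min_in) auto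
  then show thesis
    using that by auto
qed

lemma connected_graph_boundary_edge:
  assumes "connected_graph V E" "C \<subset> V" "C \<noteq> {}"
  obtains w x where "w \<in> C" "x \<notin> C" "E w x"
proof -
  obtain u y where "u \<in> C" "y \<in> V" "y \<notin> C"
    using assms by blast
  then have "E\<^sup>*\<^sup>* u y"
    using assms by (auto simp: connected_graph_def)
  then have "y \<in> C \<or> (\<exists>w x. w \<in> C \<and> x \<notin> C \<and> E w x)"
    using \<open>u \<in> C\<close> by (induction rule: rtranclp_induct) auto
  then show thesis
    using \<open>y \<notin> C\<close> that by blast
qed

lemma kforce_step_increasing: "C \<subseteq> kforce_step k V E C"
  by (auto simp: kforce_step_def)

lemma kforce_step_subset: "C \<subseteq> V \<Longrightarrow> kforce_step k V E C \<subseteq> V"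
  by (auto simp: kforce_step_def neighbors_def)

lemma mono_kforce_step:
  assumes "finite V"
  shows "mono (kforce_step k V E)"
proof (rule monoI)
  fix C D :: "'a set"
  assume "C \<subseteq> D"
  have "card (neighbors V E v - D) \<le> card (neighbors V E v - C)" for v
    by (rule card_mono) (use assms \<open>C \<subseteq> D\<close> in \<open>auto simp: finite_neighbors\<close>)
  then show "kforce_step k V E C \<subseteq> kforce_step k V E D"
    using \<open>C \<subseteq> D\<close> unfolding kforce_step_def by (fastforce intro: order_trans)
qed

lemma funpow_kforce_step_increasing: "C \<subseteq> (kforce_step k V E ^^ m) C"
  by (induction m) (use kforce_step_increasing in fastforce)+

lemma funpow_kforce_step_subset: "C \<subseteq> V \<Longrightarrow> (kforce_step k V E ^^ m) C \<subseteq> V"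
  by (induction m) (simp_all add: kforce_step_subset)

lemma funpow_kforce_step_mono:
  assumes "finite V" "C \<subseteq> D"
  shows "(kforce_step k V E ^^ m) C \<subseteq> (kforce_step k V E ^^ m) D"
  using mono_kforce_step[OF assms(1)] by (intro monoD[OF mono_pow] assms(2))

definition kforces :: "nat \<Rightarrow> 'a set \<Rightarrow> ('a \<Rightarrow> 'a \<Rightarrow> bool) \<Rightarrow> 'a set \<Rightarrow> 'a set \<Rightarrow> bool" where
  "kforces k V E S C \<longleftrightarrow> (\<exists>m. C \<subseteq> (kforce_step k V E ^^ m) S)"

lemma is_kforcing_set_iff_kforces: "is_kforcing_set k V E S \<longleftrightarrow> S \<subseteq> V \<and> kforces k V E S V"
  unfolding is_kforcing_set_def kforces_def using funpow_kforce_step_subset by blast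

lemma kforces_trans:
  assumes "finite V" "kforces k V E S C" "kforces k V E C D"
  shows "kforces k V E S D"
proof -
  obtain m n where "C \<subseteq> (kforce_step k V E ^^ m) S" "D \<subseteq> (kforce_step k V E ^^ n) C"
    using assms by (auto simp: kforces_def)
  then have "D \<subseteq> (kforce_step k V E ^^ (n + m)) S"
    using funpow_kforce_step_mono[OF \<open>finite V\<close>] by (simp add: funpow_add) blast
  then show ?thesis
    by (auto simp: kforces_def)
qed

lemma kforces_Un:
  assumes "finite V" "kforces k V E S C"
  shows "kforces k V E (S \<union> T) (C \<union> T)"
proof -
  obtain m where "C \<subseteq> (kforce_step k V E ^^ m) S"
    using assms by (auto simp: kforces_def)
  also have "\<dots> \<subseteq> (kforce_step k V E ^^ m) (S \<union> T)"
    using \<open>finite V\<close> by (intro funpow_kforce_step_mono) auto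
  finally have "C \<subseteq> (kforce_step k V E ^^ m) (S \<union> T)" .
  moreover have "S \<union> T \<subseteq> (kforce_step k V E ^^ m) (S \<union> T)"
    by (rule funpow_kforce_step_increasing)
  ultimately have "C \<union> T \<subseteq> (kforce_step k V E ^^ m) (S \<union> T)"
    by simp
  then show ?thesis
    by (auto simp: kforces_def)
qed

lemma kforces_neighbors:
  assumes "w \<in> C" "card (neighbors V E w - C) \<le> k"
  shows "kforces k V E C (C \<union> neighbors V E w)"
proof -
  have "C \<union> neighbors V E w \<subseteq> (kforce_step k V E ^^ 1) C"
    using assms by (auto simp: kforce_step_def)
  then show ?thesis
    unfolding kforces_def by blast
qed

lemma obtain_subset_kforces_neighbors:
  assumes "finite V" "w \<in> C"
  obtains T where "T \<subseteq> neighbors V E w - C" "card T = card (neighbors V E w - C) - k"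
    "kforces k V E (C \<union> T) (C \<union> neighbors V E w)"
proof -
  let ?U = "neighbors V E w - C"
  obtain T where T: "T \<subseteq> ?U" "card T = card ?U - k"
    using obtain_subset_with_card_n[of "card ?U - k" ?U] by auto
  have "neighbors V E w - (C \<union> T) = ?U - T"
    by auto
  moreover have "card (?U - T) \<le> k"
    using T finite_neighbors[OF \<open>finite V\<close>] by (simp add: card_Diff_subset finite_subset)
  ultimately have "kforces k V E (C \<union> T) (C \<union> T \<union> neighbors V E w)"
    using \<open>w \<in> C\<close> by (intro kforces_neighbors) auto
  moreover have "C \<union> T \<union> neighbors V E w = C \<union> neighbors V E w"
    using T by auto
  ultimately show thesis
    using T that by simp
qed

lemma is_kforcing_set_vertices: "is_kforcing_set k V E V"
  by (auto simp: is_kforcing_set_def intro: exI[of _ 0])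

lemma is_kforcing_set_Un:
  assumes "finite V" "kforces k V E S C" "is_kforcing_set k V E (C \<union> T)" "S \<subseteq> V"
  shows "is_kforcing_set k V E (S \<union> T)"
  using kforces_trans[OF assms(1) kforces_Un[OF assms(1,2)]] assms(3,4)
  by (auto simp: is_kforcing_set_iff_kforces)

lemma mult_diff_le_diff_mult:
  fixes d k u :: nat
  assumes "u \<le> d"
  shows "d * (u - k) \<le> (d - k) * u"
proof -
  have "d * u - d * k \<le> d * u - k * u"
    using assms by (intro diff_le_mono2) (simp add: mult.commute)
  then show ?thesis
    by (simp add: diff_mult_distrib diff_mult_distrib2)
qed

lemma obtain_kforces_extension:
  assumes graph: "simple_graph V E" and conn: "connected_graph V E"
    and deg: "\<And>w. w \<in> V \<Longrightarrow> degree V E w \<le> d + 1"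
    and C: "C \<subset> V" "C \<noteq> {}"
    and uncolored: "\<And>w. w \<in> C \<Longrightarrow> card (neighbors V E w - C) \<le> d"
  obtains U T where "U \<noteq> {}" "U \<subseteq> V - C" "T \<subseteq> U" "d * card T \<le> (d - k) * card U"
    "kforces k V E (C \<union> T) (C \<union> U)"
    "\<And>z. z \<in> C \<union> U \<Longrightarrow> card (neighbors V E z - (C \<union> U)) \<le> d"
proof -
  have finV: "finite V" and inV: "\<And>x y. E x y \<Longrightarrow> x \<in> V \<and> y \<in> V"
    using graph by (auto simp: simple_graph_def)
  obtain w x where w: "w \<in> C" and x: "x \<notin> C" "E w x"
    using connected_graph_boundary_edge[OF conn C] .
  define U where "U = neighbors V E w - C"
  have CU: "C \<union> U = C \<union> neighbors V E w"
    by (auto simp: U_def)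
  obtain T where T: "T \<subseteq> U" "card T = card U - k" "kforces k V E (C \<union> T) (C \<union> U)"
    unfolding CU unfolding U_def using obtain_subset_kforces_neighbors[OF finV w] .
  have U: "U \<noteq> {}" "U \<subseteq> V - C"
    using x inV by (auto simp: U_def neighbors_def)
  have cost: "d * card T \<le> (d - k) * card U"
    using mult_diff_le_diff_mult uncolored[OF w] T by (simp add: U_def)
  have "card (neighbors V E z - (C \<union> U)) \<le> d" if "z \<in> C \<union> U" for z
    using card_neighbors_Diff_Un_neighbors_le[OF graph deg w uncolored] that by (simp add: CU)
  then show thesis
    using that[OF U T(1) cost T(3)] by blast
qed

lemma kforcing_set_extension:
  assumes graph: "simple_graph V E" and conn: "connected_graph V E"
    and deg: "\<And>w. w \<in> V \<Longrightarrow> degree V E w \<le> d + 1"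
    and "C \<subseteq> V" "C \<noteq> {}" "\<And>w. w \<in> C \<Longrightarrow> card (neighbors V E w - C) \<le> d"
  shows "\<exists>T\<subseteq>V - C. is_kforcing_set k V E (C \<union> T) \<and> d * card T \<le> (d - k) * card (V - C)"
  using assms(4-)
proof (induction "card (V - C)" arbitrary: C rule: less_induct)
  case less
  have finV: "finite V"
    using graph by (simp add: simple_graph_def)
  show ?case
  proof (cases "C = V")
    case True
    then show ?thesis
      using is_kforcing_set_vertices by (intro exI[of _ "{}"]) simp
  next
    case False
    then have "C \<subset> V"
      using less.prems by blast
    then obtain U T where U: "U \<noteq> {}" "U \<subseteq> V - C"
      and T: "T \<subseteq> U" "d * card T \<le> (d - k) * card U" "kforces k V E (C \<union> T) (C \<union> U)"
      and uncolored: "\<And>z. z \<in> C \<union> U \<Longrightarrow> card (neighbors V E z - (C \<union> U)) \<le> d"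
      using obtain_kforces_extension[OF graph conn deg _ less.prems(2,3)] by metis
    have "V - C - U = V - (C \<union> U)" "(V - C) \<inter> U = U"
      using U by auto
    then have card_split: "card (V - C) = card U + card (V - (C \<union> U))"
      using card_Int_Diff[of "V - C" U] finV by simp
    then have "card (V - (C \<union> U)) < card (V - C)"
      using U finV finite_subset[of U V] by (auto simp: card_gt_0_iff)
    then obtain T' where T': "T' \<subseteq> V - (C \<union> U)" "is_kforcing_set k V E (C \<union> U \<union> T')"
        "d * card T' \<le> (d - k) * card (V - (C \<union> U))"
      using less.hyps[of "C \<union> U"] less.prems U uncolored by blast
    have "is_kforcing_set k V E (C \<union> (T \<union> T'))"
      using is_kforcing_set_Un[OF finV T(3) T'(2)] less.prems(1) U T(1) by (auto simp: Un_assoc)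
    moreover have "d * card (T \<union> T') \<le> d * card T + d * card T'"
      by (metis card_Un_le distrib_left mult_le_mono2)
    then have "d * card (T \<union> T') \<le> (d - k) * card (V - C)"
      using T(2) T'(3) by (simp add: card_split distrib_left)
    ultimately show ?thesis
      using U T T' by (intro exI[of _ "T \<union> T'"]) auto
  qed
qed

lemma kforcing_number_le: "is_kforcing_set k V E S \<Longrightarrow> kforcing_number k V E \<le> card S"
  unfolding kforcing_number_def by (rule Least_le) auto

lemma kforcing_number_attained:
  obtains S where "is_kforcing_set k V E S" "card S = kforcing_number k V E"
  using LeastI_ex[of "\<lambda>c. \<exists>S. is_kforcing_set k V E S \<and> card S = c"]
    is_kforcing_set_vertices that
  unfolding kforcing_number_def by blast

text \<open>Truncated subtraction in \<open>degree V E v - k\<close> covers the case where \<open>v\<close> forces all of its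
  neighbors alone.\<close>

lemma kforcing_number_le_degree:
  assumes graph: "simple_graph V E" and conn: "connected_graph V E" and v: "v \<in> V"
    and deg: "\<And>w. w \<in> V \<Longrightarrow> degree V E w \<le> d + 1"
  shows "d * kforcing_number k V E + (d - k) * (degree V E v + 1)
    \<le> d * (1 + (degree V E v - k)) + (d - k) * card V"
proof -
  have finV: "finite V" and irrefl: "\<not> E v v"
    using graph by (auto simp: simple_graph_def)
  define N where "N = neighbors V E v"
  have N: "N \<subseteq> V" "v \<notin> N" "finite N" "card N = degree V E v"
    using irrefl finV by (auto simp: N_def neighbors_def degree_def)
  have uncolored: "card (neighbors V E w - ({v} \<union> N)) \<le> d" if "w \<in> {v} \<union> N" for w
    using card_neighbors_Diff_Un_neighbors_le[OF graph deg, of v "{v}" w] that by (simp add: N_def)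
  have "{v} \<union> N \<subseteq> V"
    using v N by auto
  then obtain T' where T': "is_kforcing_set k V E ({v} \<union> N \<union> T')"
      "d * card T' \<le> (d - k) * card (V - ({v} \<union> N))"
    using kforcing_set_extension[OF graph conn deg _ _ uncolored, where k = k] by auto
  obtain T where T: "T \<subseteq> N - {v}" "card T = card (N - {v}) - k"
      "kforces k V E ({v} \<union> T) ({v} \<union> N)"
    unfolding N_def using obtain_subset_kforces_neighbors[OF finV singletonI] .
  have "is_kforcing_set k V E ({v} \<union> T \<union> T')"
    using is_kforcing_set_Un[OF finV T(3) T'(1)] v N(1) T(1) by auto
  then have "kforcing_number k V E \<le> card ({v} \<union> T \<union> T')"
    by (rule kforcing_number_le)
  also have "\<dots> \<le> 1 + (degree V E v - k) + card T'"
    using card_Un_le[of "{v} \<union> T" T'] card_Un_le[of "{v}" T] T(2) N by simp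
  finally have "d * kforcing_number k V E \<le> d * (1 + (degree V E v - k)) + d * card T'"
    by (simp only: mult_le_mono2 flip: distrib_left)
  moreover have "card V = (degree V E v + 1) + card (V - ({v} \<union> N))"
    using card_Int_Diff[OF finV, of "{v} \<union> N"] v N by (simp add: Int_absorb1)
  then have "(d - k) * card V = (d - k) * (degree V E v + 1) + (d - k) * card (V - ({v} \<union> N))"
    by (simp only: distrib_left)
  ultimately show ?thesis
    using T'(2) by linarith
qed

lemma is_kforcing_set_stable_imp_eq:
  assumes "is_kforcing_set k V E S" "kforce_step k V E S = S"
  shows "S = V"
proof -
  have "(kforce_step k V E ^^ m) S = S" for m
    by (induction m) (simp_all add: assms(2))
  then show ?thesis
    using assms(1) by (auto simp: is_kforcing_set_def)
qed

lemma min_degree_diff_less_card_kforcing_set: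
  assumes graph: "simple_graph V E" and "V \<noteq> {}" and S: "is_kforcing_set k V E S"
  shows "min_degree V E - k < card S"
proof (rule ccontr)
  assume small: "\<not> min_degree V E - k < card S"
  have finV: "finite V" and irrefl: "\<And>v. \<not> E v v"
    using graph by (auto simp: simple_graph_def)
  have "S \<subseteq> V"
    using S by (simp add: is_kforcing_set_def)
  then have "finite S"
    using finV finite_subset by blast
  have stuck: "k < card (neighbors V E v - S)" if "v \<in> S" for v
  proof -
    have "degree V E v - card (S - {v}) \<le> card (neighbors V E v - (S - {v}))"
      unfolding degree_def using \<open>finite S\<close> by (intro diff_card_le_card_Diff) simp
    moreover have "neighbors V E v - (S - {v}) = neighbors V E v - S"
      using irrefl by (auto simp: neighbors_def)
    moreover have "min_degree V E \<le> degree V E v"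
      using that \<open>S \<subseteq> V\<close> finV by (intro min_degree_le_degree) auto
    moreover have "card (S - {v}) < card S"
      using that \<open>finite S\<close> by (rule card_Diff1_less[rotated])
    ultimately show ?thesis
      using small by simp
  qed
  have "kforce_step k V E S = S"
    by (auto simp: kforce_step_def dest: stuck)
  then have "S = V"
    by (rule is_kforcing_set_stable_imp_eq[OF S])
  then have "neighbors V E v - S = {}" for v
    by (auto simp: neighbors_def)
  then show False
    using stuck \<open>S = V\<close> \<open>V \<noteq> {}\<close> by (metis card.empty ex_in_conv not_less_zero)
qed

lemma kforcing_number_eq_if_max_degree_le:
  assumes graph: "simple_graph V E" and conn: "connected_graph V E"
    and "1 \<le> k" "max_degree V E \<le> k + 1"
  shows "kforcing_number k V E = 1 + (min_degree V E - k)"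
proof (rule antisym)
  have finV: "finite V" and "V \<noteq> {}"
    using graph conn by (auto simp: simple_graph_def connected_graph_def)
  then obtain v where v: "v \<in> V" "degree V E v = min_degree V E"
    using min_degree_attained by blast
  have "degree V E w \<le> k + 1" if "w \<in> V" for w
    using degree_le_max_degree[OF finV that] assms(4) by (rule order_trans)
  from kforcing_number_le_degree[OF graph conn v(1) this, of k]
  have "k * kforcing_number k V E \<le> k * (1 + (min_degree V E - k))"
    by (simp add: v(2))
  then show "kforcing_number k V E \<le> 1 + (min_degree V E - k)"
    using \<open>1 \<le> k\<close> by (simp only: mult_le_cancel1)
  obtain S where S: "is_kforcing_set k V E S" "card S = kforcing_number k V E"
    using kforcing_number_attained .
  show "1 + (min_degree V E - k) \<le> kforcing_number k V E"
    using min_degree_diff_less_card_kforcing_set[OF graph \<open>V \<noteq> {}\<close> S(1)] S(2) by simp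
qed

lemma kforcing_number_le_real:
  assumes graph: "simple_graph V E" and conn: "connected_graph V E" and v: "v \<in> V"
    and max_degree: "k + 1 \<le> max_degree V E"
  shows "(real (max_degree V E) - 1) * real (kforcing_number k V E)
    \<le> (real (max_degree V E) - real k - 1) * real (card V)
      + max (real (degree V E v) * (real k + 1 - real (max_degree V E)) + real k)
            (real k * (real (degree V E v) - real (max_degree V E) + 2))"
    (is "_ \<le> _ + max ?A ?B")
proof -
  let ?m = "degree V E v"
  define d where "d = max_degree V E - 1"
  have max_d: "max_degree V E = d + 1" and "k \<le> d"
    using max_degree by (auto simp: d_def)
  have deg: "degree V E w \<le> d + 1" if "w \<in> V" for w
    using graph that unfolding max_d[symmetric]
    by (intro degree_le_max_degree) (auto simp: simple_graph_def)
  have "real (d * kforcing_number k V E + (d - k) * (?m + 1))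
      \<le> real (d * (1 + (?m - k)) + (d - k) * card V)"
    using kforcing_number_le_degree[OF graph conn v deg] by (simp only: of_nat_le_iff)
  then have "real d * real (kforcing_number k V E) \<le> (real d - real k) * real (card V)
      + (real d * (1 + real (?m - k)) - (real d - real k) * (real ?m + 1))"
    using \<open>k \<le> d\<close> by (simp only: of_nat_add of_nat_mult of_nat_diff of_nat_1)
  also have "real d * (1 + real (?m - k)) - (real d - real k) * (real ?m + 1) \<le> max ?A ?B"
  proof (cases "k \<le> ?m")
    case True
    then have "real d * (1 + real (?m - k)) - (real d - real k) * (real ?m + 1) = ?B"
      by (simp add: max_d of_nat_diff algebra_simps)
    then show ?thesis
      by simp
  next
    case False
    then have "real d * (1 + real (?m - k)) - (real d - real k) * (real ?m + 1) = ?A"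
      by (simp add: max_d algebra_simps)
    then show ?thesis
      by simp
  qed
  finally show ?thesis
    by (simp add: max_d)
qed

theorem theorem1:
  fixes k :: nat and V :: "'a set" and E :: "'a \<Rightarrow> 'a \<Rightarrow> bool"
  assumes "k \<ge> 1"
    and "simple_graph V E"
    and "connected_graph V E"
    and "max_degree V E \<ge> k + 1"
  shows "(min_degree V E < max_degree V E \<and> max_degree V E = k + 1
            \<longrightarrow> kforcing_number k V E = 1)
       \<and> (min_degree V E = k + 1 \<and> max_degree V E = k + 1
            \<longrightarrow> kforcing_number k V E = 2)
       \<and> (max_degree V E \<ge> k + 2 \<longrightarrow>
            real (kforcing_number k V E) \<le>
              ((real (max_degree V E) - real k - 1) * real (card V)
               + max (real (min_degree V E) * (real k + 1 - real (max_degree V E)) + real k)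
                     (real k * (real (min_degree V E) - real (max_degree V E) + 2)))
              / (real (max_degree V E) - 1))"
proof -
  have "finite V" "V \<noteq> {}"
    using assms by (auto simp: simple_graph_def connected_graph_def)
  then obtain v where v: "v \<in> V" "degree V E v = min_degree V E"
    using min_degree_attained by blast
  have "kforcing_number k V E = 1 + (min_degree V E - k)" if "max_degree V E = k + 1"
    using assms that by (intro kforcing_number_eq_if_max_degree_le) auto
  moreover have "0 < real (max_degree V E) - 1"
    using assms by simp
  ultimately show ?thesis
    using kforcing_number_le_real[OF assms(2,3) v(1) assms(4)]
    by (simp add: v(2) pos_le_divide_eq mult.commute)
qed

end
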